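(* Let $D\subset \ell^\infty$ be a subspace with a countable Hamel basis $W=\{w^i\}_{i=1}^\infty$ and assume $D\cap c=\{0\}$. Let $E$ be a separable Banach space. Then there exists an isometry $T:E\to \ell^\infty$ such that $$T(E)\cap (D+c)=\{0\}.$$ In particular, there exists a subspace $Z\subset\ell^\infty$ such that $D\subset Z$, $Z$ contains an isometric copy of $E$, and $Z\cap c=\{0\}$.
   Context: The scalar field is $\mathbb{K}=\mathbb{R}$ or $\mathbb{C}$. $\ell^\infty$ is the Banach space of all bounded $\mathbb{K}$-valued sequences $(x_n)_{n=1}^\infty$ with the sup norm $\|\cdot\|_\infty$, and $c\subset\ell^\infty$ is the subspace of convergent sequences. Subspace means linear subspace (not necessarily closed; $Z$ is not claimed to be closed). "Isometry $T:E\to\ell^\infty$" means a linear isometric embedding, not necessarily onto: $T$ is linear and $\|T(x)\|_\infty=\|x\|$ for all $x\in E$. An isometric copy of $E$ is the image of such an embedding. *)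

theory Defs
  imports "HOL-Analysis.Analysis"
begin

text \<open>
  The scalar field is \<open>\<real>\<close> or \<open>\<complex>\<close>: a type of this class is isomorphic, as a normed real
  algebra, to \<^typ>\<open>real\<close> or to \<^typ>\<open>complex\<close>, and both of these are instances.
\<close>

class real_or_complex = real_normed_field +
  assumes real_or_complex:
    "(\<exists>\<phi> :: 'a \<Rightarrow> real. bij \<phi> \<and> (\<forall>x y. \<phi> (x + y) = \<phi> x + \<phi> y) \<and> (\<forall>x y. \<phi> (x * y) = \<phi> x * \<phi> y)
        \<and> (\<forall>r x. \<phi> (r *\<^sub>R x) = r *\<^sub>R \<phi> x) \<and> (\<forall>x. norm (\<phi> x) = norm x))
     \<or> (\<exists>\<phi> :: 'a \<Rightarrow> complex. bij \<phi> \<and> (\<forall>x y. \<phi> (x + y) = \<phi> x + \<phi> y) \<and> (\<forall>x y. \<phi> (x * y) = \<phi> x * \<phi> y)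
        \<and> (\<forall>r x. \<phi> (r *\<^sub>R x) = r *\<^sub>R \<phi> x) \<and> (\<forall>x. norm (\<phi> x) = norm x))"

instance real :: real_or_complex
  by standard (rule disjI1, rule exI[of _ id], simp)

instance complex :: real_or_complex
  by standard (rule disjI2, rule exI[of _ id], simp)

text \<open>
  The library's normed spaces are real. A normed space over \<open>'k\<close> is a real normed space together
  with a scalar multiplication by \<open>'k\<close> that extends \<^const>\<open>scaleR\<close> and for which the norm is
  absolutely homogeneous.
\<close>

locale normed_space_over = vector_space smul
  for smul :: "'k::real_or_complex \<Rightarrow> 'e::real_normed_vector \<Rightarrow> 'e" +
  assumes scale_of_real: "smul (of_real r) x = r *\<^sub>R x"
    and norm_scale: "norm (smul a x) = norm a * norm x"

lemma normed_space_over_scaleR: "normed_space_over (scaleR :: real \<Rightarrow> 'e::real_normed_vector \<Rightarrow> 'e)"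
  by unfold_locales (auto simp: algebra_simps)

text \<open>
  Every function on the discrete space \<^typ>\<open>nat\<close> is continuous, so the bounded continuous functions
  on \<^typ>\<open>nat\<close> are the bounded sequences, and their norm is the sup norm. Indices start at \<open>0\<close>.
\<close>

type_synonym 'k linf = "nat \<Rightarrow>\<^sub>C 'k"

lemma norm_linf: "norm x = (SUP n. norm (apply_bcontfun x n))" for x :: "'k::real_normed_field linf"
  by (simp add: norm_bcontfun_def dist_bcontfun.rep_eq)

definition linf_scale :: "'k::real_normed_field \<Rightarrow> 'k linf \<Rightarrow> 'k linf"
  where "linf_scale a x = Bcontfun (\<lambda>n. a * apply_bcontfun x n)"

lemma linf_scale_apply [simp]: "apply_bcontfun (linf_scale a x) n = a * apply_bcontfun x n"
proof -
  have "bounded (range (\<lambda>n. a * apply_bcontfun x n))"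
    using bounded_linear_image[OF bounded_apply_bcontfun bounded_linear_mult_right]
    by (simp add: image_image)
  then have "(\<lambda>n. a * apply_bcontfun x n) \<in> bcontfun"
    by (simp add: bcontfun_def)
  then show ?thesis
    by (simp add: linf_scale_def Bcontfun_inverse)
qed

definition conv_seqs :: "'k::real_normed_field linf set"
  where "conv_seqs = {x. convergent (apply_bcontfun x)}"

definition isometric_embedding ::
    "('k::real_normed_field \<Rightarrow> 'e::real_normed_vector \<Rightarrow> 'e) \<Rightarrow> ('e \<Rightarrow> 'k linf) \<Rightarrow> bool"
  where "isometric_embedding smul T \<longleftrightarrow>
    Vector_Spaces.linear smul linf_scale T \<and> (\<forall>x. norm (T x) = norm x)"

interpretation linf: normed_space_over "linf_scale :: 'k::real_or_complex \<Rightarrow> 'k linf \<Rightarrow> 'k linf"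
proof
  fix a b :: 'k and x y :: "'k linf" and r :: real
  show "linf_scale a (x + y) = linf_scale a x + linf_scale a y"
    "linf_scale (a + b) x = linf_scale a x + linf_scale b x"
    "linf_scale a (linf_scale b x) = linf_scale (a * b) x"
    "linf_scale 1 x = x"
    "linf_scale (of_real r) x = r *\<^sub>R x"
    by (rule bcontfun_eqI; simp add: algebra_simps scaleR_conv_of_real)+
  have le: "norm (linf_scale c z) \<le> norm c * norm z" for c :: 'k and z :: "'k linf"
    by (rule norm_bound) (simp add: norm_mult mult_left_mono norm_bounded)
  have *: "linf_scale c (linf_scale d z) = linf_scale (c * d) z" for c d :: 'k and z
    by (rule bcontfun_eqI) simp
  have 1: "linf_scale 1 z = z" for z :: "'k linf"
    by (rule bcontfun_eqI) simp
  show "norm (linf_scale a x) = norm a * norm x"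
  proof (cases "a = 0")
    case True
    then show ?thesis using le[of a x] by simp
  next
    case False
    have "norm x \<le> inverse (norm a) * norm (linf_scale a x)"
      using le[of "inverse a" "linf_scale a x"] False by (simp add: * 1 norm_inverse)
    then have "norm a * norm x \<le> norm (linf_scale a x)"
      using False by (simp add: field_simps)
    then show ?thesis
      using le[of a x] by simp
  qed
qed

end

theory Submission
  imports Defs "HOL-Library.Diagonal_Subsequence"
begin

text \<open>
  By a diagonal argument there is a subsequence of indices along which every element of \<open>W\<close>, hence
  every element of \<open>D + c\<close>, converges. Let \<open>f\<^sub>j\<close> be a norming sequence of functionals on \<open>E\<close>
  and let \<open>T x\<close> vanish off the subsequence and take on it each of the values \<open>f\<^sub>j x\<close> and
  \<open>- f\<^sub>j x\<close> infinitely often. Then \<open>T\<close> is isometric, and \<open>T x\<close> can converge along the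
  subsequence only if all \<open>f\<^sub>j x\<close> vanish, that is, \<open>x = 0\<close>. For the second claim take
  \<open>Z = D + T(E)\<close>.
\<close>

section \<open>The Hahn--Banach theorem\<close>

definition sublinear :: "('a::real_vector \<Rightarrow> real) \<Rightarrow> bool"
  where "sublinear p \<longleftrightarrow> (\<forall>x y. p (x + y) \<le> p x + p y) \<and> (\<forall>c x. 0 \<le> c \<longrightarrow> p (c *\<^sub>R x) = c * p x)"

lemma sublinear_add: "sublinear p \<Longrightarrow> p (x + y) \<le> p x + p y"
  and sublinear_scale: "sublinear p \<Longrightarrow> 0 \<le> c \<Longrightarrow> p (c *\<^sub>R x) = c * p x"
  by (auto simp: sublinear_def)

lemma sublinear_zero: "sublinear p \<Longrightarrow> p 0 = 0"
  using sublinear_scale[of p 0 0] by simp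

lemma sublinear_minus: "sublinear p \<Longrightarrow> - p (- x) \<le> p x"
  using sublinear_add[of p x "- x"] sublinear_zero[of p] by simp

text \<open>One inequality for positive factors suffices: applied to \<open>inverse c\<close> and
  \<open>c *\<^sub>R x\<close>, it gives the reverse one.\<close>

lemma sublinearI:
  fixes p :: "'a::real_vector \<Rightarrow> real"
  assumes add: "\<And>x y. p (x + y) \<le> p x + p y"
    and zero: "p 0 = 0"
    and le: "\<And>c x. 0 < c \<Longrightarrow> p (c *\<^sub>R x) \<le> c * p x"
  shows "sublinear p"
proof -
  have "p (c *\<^sub>R x) = c * p x" if "0 \<le> c" for c x
  proof (cases "c = 0")
    case False
    then have c: "0 < c" using that by simp
    have "p (inverse c *\<^sub>R (c *\<^sub>R x)) \<le> inverse c * p (c *\<^sub>R x)"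
      using c by (intro le) simp
    then have "c * p x \<le> p (c *\<^sub>R x)"
      using c by (simp add: field_simps)
    with le[OF c] show ?thesis by (rule antisym)
  qed (simp add: zero)
  with add show ?thesis by (simp add: sublinear_def)
qed

lemma sublinear_norm: "sublinear norm"
  by (simp add: sublinear_def norm_triangle_ineq)

text \<open>
  The largest sublinear functional below \<open>p\<close> whose value at \<open>- v\<close> is at most \<open>- p v\<close>.
\<close>

definition tilt :: "('a::real_vector \<Rightarrow> real) \<Rightarrow> 'a \<Rightarrow> 'a \<Rightarrow> real"
  where "tilt p v y = (INF t\<in>{0..}. p (y + t *\<^sub>R v) - t * p v)"

context
  fixes p :: "'a::real_vector \<Rightarrow> real" and v :: 'a
  assumes p: "sublinear p"
begin

text \<open>Makes the infimum in \<open>tilt\<close> finite: subadditivity is applied to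
  \<open>t *\<^sub>R v = (y + t *\<^sub>R v) + (- y)\<close>, and the bound does not depend on
  \<open>t\<close>.\<close>

lemma tilt_bound: "0 \<le> t \<Longrightarrow> - p (- y) \<le> p (y + t *\<^sub>R v) - t * p v"
  using sublinear_add[OF p, of "y + t *\<^sub>R v" "- y"] sublinear_scale[OF p, of t v] by simp

lemma tilt_le: "0 \<le> t \<Longrightarrow> tilt p v y \<le> p (y + t *\<^sub>R v) - t * p v"
  unfolding tilt_def
  by (rule cINF_lower) (auto intro!: bdd_belowI2[where m = "- p (- y)"] tilt_bound)

lemma tilt_greatest: "(\<And>t. 0 \<le> t \<Longrightarrow> m \<le> p (y + t *\<^sub>R v) - t * p v) \<Longrightarrow> m \<le> tilt p v y"
  unfolding tilt_def by (rule cINF_greatest) auto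

lemma tilt_le_self: "tilt p v y \<le> p y"
  using tilt_le[of 0 y] by simp

lemma tilt_minus: "tilt p v (- v) \<le> - p v"
  using tilt_le[of 1 "- v"] sublinear_zero[OF p] by simp

lemma sublinear_tilt: "sublinear (tilt p v)"
proof (rule sublinearI)
  fix x y
  \<comment> \<open>The parameters \<open>s\<close> and \<open>t\<close> of the summands combine to
    \<open>s + t\<close> for the sum; the infimum is then taken over \<open>t\<close> first and over
    \<open>s\<close> second.\<close>
  have "tilt p v (x + y) \<le> (p (x + s *\<^sub>R v) - s * p v) + (p (y + t *\<^sub>R v) - t * p v)"
    if "0 \<le> s" "0 \<le> t" for s t
  proof -
    have "tilt p v (x + y) \<le> p ((x + s *\<^sub>R v) + (y + t *\<^sub>R v)) - (s + t) * p v"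
      using tilt_le[of "s + t" "x + y"] that by (simp add: algebra_simps)
    also have "\<dots> \<le> p (x + s *\<^sub>R v) + p (y + t *\<^sub>R v) - (s + t) * p v"
      using sublinear_add[OF p] by simp
    finally show ?thesis by (simp add: algebra_simps)
  qed
  then have "tilt p v (x + y) - (p (x + s *\<^sub>R v) - s * p v) \<le> tilt p v y" if "0 \<le> s" for s
    using that by (intro tilt_greatest) (simp only: diff_le_eq add.commute)
  then have "tilt p v (x + y) - tilt p v y \<le> tilt p v x"
    by (intro tilt_greatest) (simp add: algebra_simps)
  then show "tilt p v (x + y) \<le> tilt p v x + tilt p v y" by simp
next
  have "0 \<le> tilt p v 0"
    by (rule tilt_greatest) (simp add: sublinear_scale[OF p])
  then show "tilt p v 0 = 0"
    using tilt_le_self[of 0] sublinear_zero[OF p] by simp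
next
  fix c :: real and x
  assume c: "0 < c"
  \<comment> \<open>Rescaling the parameter from \<open>t\<close> to \<open>c * t\<close> turns a
    term for \<open>x\<close> into one for \<open>c *\<^sub>R x\<close>.\<close>
  have "tilt p v (c *\<^sub>R x) / c \<le> tilt p v x"
  proof (rule tilt_greatest)
    fix t :: real
    assume "0 \<le> t"
    then have "tilt p v (c *\<^sub>R x) \<le> p (c *\<^sub>R (x + t *\<^sub>R v)) - (c * t) * p v"
      using tilt_le[of "c * t" "c *\<^sub>R x"] c by (simp add: algebra_simps)
    also have "\<dots> = c * (p (x + t *\<^sub>R v) - t * p v)"
      using c by (simp only: sublinear_scale[OF p less_imp_le[OF c]]) (simp add: algebra_simps)
    finally show "tilt p v (c *\<^sub>R x) / c \<le> p (x + t *\<^sub>R v) - t * p v"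
      using c by (simp add: field_simps)
  qed
  then show "tilt p v (c *\<^sub>R x) \<le> c * tilt p v x"
    using c by (simp add: field_simps)
qed

end

section \<open>Minimal sublinear functionals by Zorn's lemma\<close>

lemma sublinear_INF_chain:
  fixes p :: "'a::real_vector \<Rightarrow> real"
  assumes "C \<noteq> {}" and sub: "\<And>q. q \<in> C \<Longrightarrow> sublinear q" and le: "\<And>q. q \<in> C \<Longrightarrow> q \<le> p"
    and chain: "\<And>q q'. q \<in> C \<Longrightarrow> q' \<in> C \<Longrightarrow> q \<le> q' \<or> q' \<le> q"
  shows "sublinear (\<lambda>x. INF q\<in>C. q x)" and "\<And>q. q \<in> C \<Longrightarrow> (\<lambda>x. INF q\<in>C. q x) \<le> q"
proof -
  define u where "u x = (INF q\<in>C. q x)" for x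
  \<comment> \<open>A lower bound common to all of \<open>C\<close>, so that the pointwise infimum
    is finite.\<close>
  have "- p (- x) \<le> q x" if "q \<in> C" for q x
    using sublinear_minus[OF sub[OF that], of x] le[OF that, THEN le_funD, of "- x"] by simp
  then have "bdd_below ((\<lambda>q. q x) ` C)" for x
    by (auto intro!: bdd_belowI2)
  then have u_le: "u x \<le> q x" if "q \<in> C" for q x
    unfolding u_def using that by (intro cINF_lower)
  have u_greatest: "m \<le> u x" if "\<And>q. q \<in> C \<Longrightarrow> m \<le> q x" for m x
    unfolding u_def using that \<open>C \<noteq> {}\<close> by (intro cINF_greatest)
  have "sublinear u"
  proof (rule sublinearI)
    fix x y
    \<comment> \<open>The chain condition enters here: the smaller of \<open>q\<close> and
      \<open>q'\<close> serves at both points.\<close>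
    have "u (x + y) \<le> q x + q' y" if q: "q \<in> C" "q' \<in> C" for q q'
    proof -
      obtain r where r: "r \<in> C" "r \<le> q" "r \<le> q'"
        using chain[OF q] q by blast
      have "u (x + y) \<le> r x + r y"
        using u_le[OF r(1)] sublinear_add[OF sub[OF r(1)]] order_trans by blast
      also have "\<dots> \<le> q x + q' y"
        using r by (intro add_mono) (auto dest: le_funD)
      finally show ?thesis .
    qed
    then have "u (x + y) - q x \<le> u y" if "q \<in> C" for q
      using that by (intro u_greatest) (metis add.commute diff_le_eq)
    then have "u (x + y) - u y \<le> u x"
      by (intro u_greatest) (simp add: algebra_simps)
    then show "u (x + y) \<le> u x + u y" by simp
  next
    obtain q where "q \<in> C" using \<open>C \<noteq> {}\<close> by blast
    then have "u 0 \<le> 0" using u_le[of q 0] sublinear_zero[OF sub[of q]] by simp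
    moreover have "0 \<le> u 0" by (rule u_greatest) (simp add: sublinear_zero sub)
    ultimately show "u 0 = 0" by simp
  next
    fix c :: real and x
    assume c: "0 < c"
    have "u (c *\<^sub>R x) / c \<le> u x"
      using u_le[of _ "c *\<^sub>R x"] c by (intro u_greatest) (simp add: sublinear_scale[OF sub] field_simps)
    then show "u (c *\<^sub>R x) \<le> c * u x"
      using c by (simp add: field_simps)
  qed
  then show "sublinear (\<lambda>x. INF q\<in>C. q x)"
    by (simp add: u_def[abs_def])
  show "(\<lambda>x. INF q\<in>C. q x) \<le> q" if "q \<in> C" for q
    using u_le[OF that] by (simp add: le_fun_def u_def)
qed

lemma ex_minimal_sublinear:
  fixes p :: "'a::real_vector \<Rightarrow> real"
  assumes "sublinear p"
  obtains q where "sublinear q" "q \<le> p" "\<And>r. sublinear r \<Longrightarrow> r \<le> q \<Longrightarrow> r = q"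
proof -
  define A where "A = {q. sublinear q \<and> q \<le> p}"
  \<comment> \<open>Zorn's lemma for the reversed order: lower bounds of chains are pointwise
    infima, with \<open>p\<close> itself for the empty chain.\<close>
  have "\<exists>m\<in>A. \<forall>a\<in>A. a \<le> m \<longrightarrow> a = m"
  proof (rule predicate_Zorn)
    show "partial_order_on A (relation_of (\<lambda>a b. b \<le> a) A)"
      by (rule partial_order_on_relation_ofI) auto
  next
    fix C
    assume "C \<in> Chains (relation_of (\<lambda>a b. b \<le> a) A)"
    then have C: "C \<subseteq> A" "\<And>q q'. q \<in> C \<Longrightarrow> q' \<in> C \<Longrightarrow> q \<le> q' \<or> q' \<le> q"
      by (auto simp: Chains_def relation_of_def)
    show "\<exists>u\<in>A. \<forall>a\<in>C. u \<le> a"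
    proof (cases "C = {}")
      case True
      then show ?thesis using assms by (auto simp: A_def)
    next
      case False
      have *: "\<And>q. q \<in> C \<Longrightarrow> sublinear q" "\<And>q. q \<in> C \<Longrightarrow> q \<le> p"
        using C(1) by (auto simp: A_def)
      note inf = sublinear_INF_chain[OF False * C(2)]
      obtain q where "q \<in> C" using False by blast
      then have "(\<lambda>x. INF q\<in>C. q x) \<le> p"
        using inf(2) *(2) order_trans by blast
      then show ?thesis
        using inf by (intro bexI[of _ "\<lambda>x. INF q\<in>C. q x"]) (auto simp: A_def)
    qed
  qed
  then obtain q where "q \<in> A" and "\<And>a. a \<in> A \<Longrightarrow> a \<le> q \<Longrightarrow> a = q" by blast
  then show thesis
    by (intro that[of q]) (auto simp: A_def)
qed

text \<open>Minimality makes \<open>q\<close> equal to its own tilt at every \<open>x\<close>, hence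
  odd, and an odd sublinear functional is linear.\<close>

lemma minimal_sublinear_imp_linear:
  fixes q :: "'a::real_vector \<Rightarrow> real"
  assumes q: "sublinear q" and min: "\<And>r. sublinear r \<Longrightarrow> r \<le> q \<Longrightarrow> r = q"
  shows "linear q"
proof (rule linearI)
  have minus: "q (- x) = - q x" for x
  proof -
    have "tilt q x = q"
      using q by (intro min) (auto simp: sublinear_tilt le_fun_def tilt_le_self)
    then have "q (- x) \<le> - q x"
      using tilt_minus[OF q, of x] by simp
    then show ?thesis using sublinear_minus[OF q, of x] by simp
  qed
  show "q (x + y) = q x + q y" for x y
    \<comment> \<open>The second instance, for \<open>x = (x + y) + (- y)\<close>, is
      superadditivity by oddness.\<close>
    using sublinear_add[OF q, of x y] sublinear_add[OF q, of "x + y" "- y"] minus[of y] by simp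
  show "q (c *\<^sub>R x) = c *\<^sub>R q x" for c x
    using sublinear_scale[OF q, of c x] sublinear_scale[OF q, of "- c" x] minus[of "c *\<^sub>R x"]
    by (cases "0 \<le> c") auto
qed

text \<open>A minimal functional is taken below \<open>tilt p v\<close> rather than below
  \<open>p\<close>: the bound on the tilt at \<open>- v\<close> forces equality with
  \<open>p\<close> at \<open>v\<close>.\<close>

lemma hahn_banach:
  fixes p :: "'a::real_vector \<Rightarrow> real"
  assumes p: "sublinear p"
  obtains f where "linear f" "\<And>x. f x \<le> p x" "f v = p v"
proof -
  obtain q where q: "sublinear q" "q \<le> tilt p v" "\<And>r. sublinear r \<Longrightarrow> r \<le> q \<Longrightarrow> r = q"
    using ex_minimal_sublinear[OF sublinear_tilt[OF p]] by blast
  have lin: "linear q"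
    using q(1,3) by (rule minimal_sublinear_imp_linear)
  have le: "q x \<le> p x" for x
    using q(2) tilt_le_self[OF p] order_trans by (fastforce simp: le_fun_def)
  have "q (- v) \<le> - p v"
    using q(2) tilt_minus[OF p] order_trans by (fastforce simp: le_fun_def)
  then have "q v = p v"
    using le[of v] linear_neg[OF lin, of v] by simp
  with lin le show thesis by (rule that)
qed

section \<open>The scalar field\<close>

text \<open>Expresses the class axiom inside \<open>'k\<close>, through \<open>of_real\<close> and
  an imaginary unit, for the construction of functionals. The last complex clause bounds the real
  part by the modulus.\<close>

lemma real_or_complex_cases:
  obtains (real) "range (of_real :: real \<Rightarrow> 'k::real_or_complex) = UNIV"
  | (complex) i :: "'k::real_or_complex" where "i * i = - 1"
      "\<And>z :: 'k::real_or_complex. \<exists>a b. z = of_real a + i * of_real b"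
      "\<And>a b. a \<le> norm (of_real a + i * of_real b)"
  using real_or_complex[where 'a = 'k]
proof (elim disjE exE conjE)
  fix \<phi> :: "'k \<Rightarrow> real"
  assume \<phi>: "bij \<phi>" "\<forall>x y. \<phi> (x * y) = \<phi> x * \<phi> y" "\<forall>r x. \<phi> (r *\<^sub>R x) = r *\<^sub>R \<phi> x"
  \<comment> \<open>\<open>\<phi> 1 = 1\<close> is not among the assumptions on
    \<open>\<phi>\<close>. It follows since \<open>\<phi> (e * 1) = \<phi> 1\<close> and
    \<open>\<phi>\<close> is injective, so that \<open>e = 1\<close>.\<close>
  obtain e where e: "\<phi> e = 1"
    using bij_is_surj[OF \<phi>(1)] by (metis surjD)
  have "z = \<phi> z *\<^sub>R e" for z
    using \<phi>(3) e by (intro injD[OF bij_is_inj[OF \<phi>(1)]]) simp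
  moreover have "e = 1"
  proof -
    have "\<phi> (e * 1) = \<phi> 1" using \<phi>(2) e by (metis mult_1)
    then show ?thesis
      using injD[OF bij_is_inj[OF \<phi>(1)]] by fastforce
  qed
  ultimately have "z = of_real (\<phi> z)" for z
    by (simp add: of_real_def)
  then show thesis
    by (intro real) blast
next
  fix \<phi> :: "'k \<Rightarrow> complex"
  assume \<phi>: "bij \<phi>" "\<forall>x y. \<phi> (x + y) = \<phi> x + \<phi> y" "\<forall>x y. \<phi> (x * y) = \<phi> x * \<phi> y"
    "\<forall>r x. \<phi> (r *\<^sub>R x) = r *\<^sub>R \<phi> x" "\<forall>x. norm (\<phi> x) = norm x"
  note inj = injD[OF bij_is_inj[OF \<phi>(1)]]
  obtain e where e: "\<phi> e = 1"
    using bij_is_surj[OF \<phi>(1)] by (metis surjD)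
  have "\<phi> (e * 1) = \<phi> 1" using \<phi>(3) e by (metis mult_1)
  then have "e = 1" using inj by fastforce
  with e have one: "\<phi> 1 = 1" by simp
  obtain i where i: "\<phi> i = \<i>"
    using bij_is_surj[OF \<phi>(1)] by (metis surjD)
  have "\<phi> (- 1) = - 1"
    using \<phi>(4) one by (metis scaleR_minus1_left)
  then have "i * i = - 1"
    using \<phi>(3) i by (intro inj) simp
  moreover have "z = of_real (Re (\<phi> z)) + i * of_real (Im (\<phi> z))" for z
    using \<phi>(2-4) i one
    by (intro inj) (simp add: of_real_def complex_eq_iff)
  moreover have "a \<le> norm (of_real a + i * of_real b)" for a b
  proof -
    have "\<phi> (of_real a + i * of_real b) = Complex a b"
      using \<phi>(2-4) i one by (simp add: of_real_def complex_eq_iff)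
    then have "norm (of_real a + i * of_real b) = norm (Complex a b)"
      using \<phi>(5) by metis
    then show ?thesis
      using complex_Re_le_cmod[of "Complex a b"] by simp
  qed
  ultimately show thesis
    by (intro complex) blast+
qed

text \<open>Bolzano-Weierstrass in \<open>'b\<close>, pulled back: \<open>\<phi>\<close> preserves
  distances, and its surjectivity supplies the limit in \<open>'k\<close>.\<close>

lemma convergent_subsequence_isometry:
  fixes \<phi> :: "'k::real_normed_vector \<Rightarrow> 'b::{heine_borel, real_normed_vector}"
  assumes "bij \<phi>" and add: "\<forall>x y. \<phi> (x + y) = \<phi> x + \<phi> y" and norm: "\<forall>x. norm (\<phi> x) = norm x"
    and X: "bounded (range (X :: nat \<Rightarrow> 'k))"
  obtains s :: "nat \<Rightarrow> nat" where "strict_mono s" "convergent (X \<circ> s)"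
proof -
  obtain B where "\<And>n. norm (X n) \<le> B" using X by (auto simp: bounded_iff)
  then have "bounded (range (\<lambda>n. \<phi> (X n)))"
    using norm by (intro boundedI[of _ B]) auto
  then obtain l s where s: "strict_mono s" "((\<lambda>n. \<phi> (X n)) \<circ> s) \<longlonglongrightarrow> l"
    using bounded_imp_convergent_subsequence by blast
  obtain m where m: "\<phi> m = l"
    using bij_is_surj[OF \<open>bij \<phi>\<close>] by (metis surjD)
  have "\<phi> (x - y) = \<phi> x - \<phi> y" for x y
    using add[rule_format, of "x - y" y] by simp
  then have "dist x y = dist (\<phi> x) (\<phi> y)" for x y
    using norm by (metis dist_norm)
  then have "(X \<circ> s) \<longlonglongrightarrow> m"
    using s(2) m by (simp add: tendsto_iff)
  with s(1) show thesis by (intro that[of s]) (auto simp: convergent_def)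
qed

lemma real_or_complex_convergent_subsequence:
  fixes X :: "nat \<Rightarrow> 'k::real_or_complex"
  assumes "bounded (range X)"
  obtains s :: "nat \<Rightarrow> nat" where "strict_mono s" "convergent (X \<circ> s)"
  using real_or_complex[where 'a = 'k]
  by (elim disjE exE conjE) (meson assms convergent_subsequence_isometry that)+

section \<open>Norming functionals\<close>

context normed_space_over
begin

text \<open>Hahn-Banach below the norm gives a real functional \<open>f\<close> with
  \<open>f x = norm x\<close>, and \<open>g\<close> is the \<open>'k\<close>-linear functional with
  real part \<open>f\<close>. Multiplying \<open>y\<close> by a scalar of modulus 1 makes the value
  of \<open>g\<close> real, so the bound on \<open>f\<close> passes to \<open>g\<close>.\<close>

lemma ex_norming_functional:
  obtains g where "Vector_Spaces.linear smul (*) g" "\<And>x. norm (g x) \<le> norm x" "norm x \<le> norm (g x)"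
proof -
  obtain f :: "'e \<Rightarrow> real" where f: "linear f" "\<And>y. f y \<le> norm y" "f x = norm x"
    using hahn_banach[OF sublinear_norm] by blast
  have f_scale: "f (smul (of_real r) y) = r * f y" for r y
    using linear_scale[OF f(1)] by (simp add: scale_of_real)
  have vs: "vector_space ((*) :: 'k \<Rightarrow> 'k \<Rightarrow> 'k)"
    by unfold_locales (auto simp: algebra_simps)
  obtain g where g: "Vector_Spaces.linear smul (*) g" and gf: "\<And>y r. g y = of_real r \<Longrightarrow> r = f y"
    and f_le: "f x \<le> norm (g x)"
  proof (cases rule: real_or_complex_cases[where 'k = 'k])
    case real
    define g where "g y = (of_real (f y) :: 'k)" for y
    have "Vector_Spaces.linear smul (*) g"
      unfolding Vector_Spaces.linear_iff
    proof (intro conjI allI vector_space_axioms vs)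
      fix a :: 'k and y z
      show "g (y + z) = g y + g z" by (simp add: g_def linear_add[OF f(1)])
      obtain r where "a = of_real r" using real by (metis surjD)
      then show "g (smul a y) = a * g y" by (simp add: g_def f_scale)
    qed
    then show thesis
      by (rule that) (auto simp: g_def)
  next
    case (complex i)
    text \<open>A complex-linear functional is determined by its real part.\<close>
    define g where "g y = of_real (f y) - i * of_real (f (smul i y))" for y
    \<comment> \<open>Allows real and imaginary parts to be compared when \<open>g y\<close> is
      real.\<close>
    have i: "i \<noteq> of_real b" for b
    proof
      assume "i = of_real b"
      then have "of_real (b * b) = (of_real (- 1) :: 'k)" using complex(1) by simp
      then have "b * b = - 1" by (simp only: of_real_eq_iff)
      moreover have "0 \<le> b * b" by simp
      ultimately show False by linarith
    qed
    have lin: "Vector_Spaces.linear smul (*) g"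
      unfolding Vector_Spaces.linear_iff
    proof (intro conjI allI vector_space_axioms vs)
      fix c :: 'k and y z
      show add: "g (y + z) = g y + g z" for y z
        by (simp add: g_def scale_right_distrib linear_add[OF f(1)] algebra_simps)
      \<comment> \<open>Homogeneity reduces to real scalars and to \<open>i\<close>.\<close>
      obtain a b where c: "c = of_real a + i * of_real b" using complex(2) by blast
      have g_real: "g (smul (of_real r) y) = of_real r * g y" for r y
      proof -
        have "smul i (smul (of_real r) y) = smul (of_real r) (smul i y)"
          by (simp add: mult.commute)
        then show ?thesis by (simp add: g_def f_scale right_diff_distrib del: scale_scale)
      qed
      have g_i: "g (smul i y) = i * g y" for y
      proof -
        have "smul i (smul i y) = - y" using complex(1) by simp
        moreover have "i * (i * z) = - z" for z
          using complex(1) by (metis mult.assoc mult_minus1)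
        ultimately show ?thesis
          by (simp add: g_def linear_neg[OF f(1)] right_diff_distrib del: scale_scale)
      qed
      have "smul c y = smul (of_real a) y + smul i (smul (of_real b) y)"
        by (simp add: c scale_left_distrib)
      then show "g (smul c y) = c * g y"
        by (simp only: add g_real g_i) (simp add: c algebra_simps)
    qed
    have gf: "r = f y" if "g y = of_real r" for r y
    proof -
      let ?b = "f (smul i y)"
      have eq: "i * of_real ?b = of_real (f y - r)"
        using that by (simp add: g_def algebra_simps)
      \<comment> \<open>Otherwise \<open>i\<close> would be a quotient of real numbers.\<close>
      have "?b = 0"
      proof (rule ccontr)
        assume "?b \<noteq> 0"
        then have "i = of_real ((f y - r) / ?b)"
          using eq by (simp add: field_simps)
        then show False using i by blast
      qed
      then show ?thesis using eq by (metis diff_self eq_iff_diff_eq_0 mult_zero_right of_real_0 of_real_eq_iff)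
    qed
    have "f x \<le> norm (g x)"
      using complex(3)[of "f x" "- f (smul i x)"] by (simp add: g_def)
    with lin gf show thesis by (intro that)
  qed
  interpret g: Vector_Spaces.linear smul "(*)" g by (rule g)
  have "norm (g y) \<le> norm y" for y
  proof (cases "g y = 0")
    case False
    \<comment> \<open>The scalar of modulus 1 that rotates \<open>g y\<close> to its absolute
      value.\<close>
    define u where "u = of_real (norm (g y)) / g y"
    have "g (smul u y) = of_real (norm (g y))"
      using False by (simp add: g.scale u_def)
    then have "norm (g y) = f (smul u y)" by (rule gf)
    also have "\<dots> \<le> norm (smul u y)" by (rule f(2))
    also have "\<dots> = norm y"
      using False by (simp add: norm_scale u_def norm_divide)
    finally show ?thesis .
  qed simp
  then show thesis
    using g f_le f(3) by (intro that) auto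
qed

text \<open>Norming functionals are chosen for the points of a countable dense set. The last
  conclusion states that the norm is the supremum of the \<open>norm (g j x)\<close> without naming
  a supremum; \<open>B = 0\<close> shows that the sequence separates points.\<close>

lemma ex_norming_sequence:
  assumes "separable_space (euclidean :: 'e topology)"
  obtains g :: "nat \<Rightarrow> 'e \<Rightarrow> 'k"
  where "\<And>j. Vector_Spaces.linear smul (*) (g j)" "\<And>j x. norm (g j x) \<le> norm x"
    "\<And>x B. (\<And>j. norm (g j x) \<le> B) \<Longrightarrow> norm x \<le> B"
proof -
  obtain C :: "'e set" where C: "countable C" "closure C = UNIV"
    using assms by (auto simp: separable_space_def)
  then have "C \<noteq> {}" by auto
  have "\<exists>g. Vector_Spaces.linear smul (*) g \<and> (\<forall>y. norm (g y) \<le> norm y) \<and> norm x \<le> norm (g x)" for x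
    using ex_norming_functional[of x] by blast
  then obtain G where G: "\<And>x. Vector_Spaces.linear smul (*) (G x)" "\<And>x y. norm (G x y) \<le> norm y"
    "\<And>x. norm x \<le> norm (G x x)"
    by metis
  have "norm x \<le> B" if B: "\<And>j. norm (G (from_nat_into C j) x) \<le> B" for x B
  proof (rule field_le_epsilon)
    fix \<epsilon> :: real
    assume "0 < \<epsilon>"
    \<comment> \<open>Half of \<open>\<epsilon>\<close>, because the distance from \<open>e\<close>
      to \<open>x\<close> is paid twice: once in the norm, once under \<open>G e\<close>.\<close>
    then obtain e where e: "e \<in> C" "dist e x < \<epsilon> / 2"
      using C(2) closure_approachable[of x C] by (metis UNIV_I half_gt_zero)
    then obtain j where j: "from_nat_into C j = e"
      using from_nat_into_surj[OF C(1)] by blast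
    interpret Vector_Spaces.linear smul "(*)" "G e" by (rule G)
    have "norm x \<le> norm e + norm (x - e)"
      using norm_triangle_ineq[of e "x - e"] by simp
    also have "norm e \<le> norm (G e e)" by (rule G)
    also have "\<dots> \<le> norm (G e x) + norm (G e (e - x))"
      using norm_triangle_ineq[of "G e x" "G e (e - x)"] by (simp add: diff)
    also have "\<dots> \<le> B + norm (e - x)"
      using B[of j] G(2)[of e "e - x"] by (simp add: j)
    finally show "norm x \<le> B + \<epsilon>"
      using e(2) by (simp add: dist_norm norm_minus_commute)
  qed
  with G show thesis
    by (intro that[of "\<lambda>j. G (from_nat_into C j)"]) auto
qed

end

section \<open>The embedding\<close>

text \<open>Cantor's diagonal argument: stage \<open>n\<close> refines the subsequence so that the
  \<open>n\<close>-th element of \<open>W\<close> converges, by boundedness.\<close>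

lemma ex_common_convergent_subsequence:
  fixes W :: "'k::real_or_complex linf set"
  assumes "countable W"
  obtains r :: "nat \<Rightarrow> nat" where "strict_mono r" "\<And>w. w \<in> W \<Longrightarrow> convergent (apply_bcontfun w \<circ> r)"
proof -
  let ?w = "\<lambda>n. apply_bcontfun (from_nat_into W n)"
  interpret subseqs "\<lambda>n s. convergent (?w n \<circ> s)"
  proof
    fix n and s :: "nat \<Rightarrow> nat"
    have "bounded (range (?w n \<circ> s))"
      by (rule bounded_subset[OF bounded_apply_bcontfun]) auto
    then show "\<exists>r'. strict_mono r' \<and> convergent (?w n \<circ> (s \<circ> r'))"
      using real_or_complex_convergent_subsequence by (metis comp_assoc)
  qed
  have "convergent (?w n \<circ> diagseq)" for n
  proof -
    \<comment> \<open>The diagonal sequence refines stage \<open>n\<close> only from index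
      \<open>Suc n\<close> on; finitely many initial terms do not affect convergence.\<close>
    have "convergent (?w n \<circ> (diagseq \<circ> (+) (Suc n)))"
      by (rule diagseq_holds) (auto simp flip: comp_assoc intro: convergent_subseq_convergent)
    then have "convergent (\<lambda>m. (?w n \<circ> diagseq) (m + Suc n))"
      by (simp add: o_def add.commute)
    then show ?thesis by (simp only: convergent_ignore_initial_segment)
  qed
  then show thesis
    using from_nat_into_surj[OF assms] by (intro that[OF subseq_diagseq]) metis
qed

text \<open>Carries convergence along \<open>r\<close> from \<open>W\<close> to its span and to sums
  with convergent sequences.\<close>

lemma subspace_convergent_along:
  "linf.subspace {x :: 'k::real_or_complex linf. convergent (apply_bcontfun x \<circ> r)}"
  by (rule linf.subspaceI)
    (auto simp: o_def intro: convergent_const convergent_add convergent_mult)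

lemma ex_embedding_divergent_along:
  fixes smul :: "'k::real_or_complex \<Rightarrow> 'e::banach \<Rightarrow> 'e"
  assumes "normed_space_over smul" and "separable_space (euclidean :: 'e topology)" and r: "strict_mono r"
  obtains T where "isometric_embedding smul T"
    "\<And>x. convergent (apply_bcontfun (T x) \<circ> r) \<Longrightarrow> x = 0"
proof -
  interpret normed_space_over smul by fact
  obtain g :: "nat \<Rightarrow> 'e \<Rightarrow> 'k" where lin: "\<And>j. Vector_Spaces.linear smul (*) (g j)"
    and g_le: "\<And>j x. norm (g j x) \<le> norm x"
    and g_norming: "\<And>x B. (\<And>j. norm (g j x) \<le> B) \<Longrightarrow> norm x \<le> B"
    using ex_norming_sequence[OF assms(2)] by blast
  have g_add: "g j (x + y) = g j x + g j y" and g_scale: "g j (smul a x) = a * g j x" for j x y a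
    using lin[of j] by (simp_all add: Vector_Spaces.linear_iff)
  \<comment> \<open>The position \<open>inv r n\<close> in the subsequence codes a pair:
    \<open>j\<close> selects the functional and \<open>m\<close> the sign, so each \<open>j\<close>
    recurs infinitely often with both signs.\<close>
  define h where "h x n = (if n \<in> range r
    then (case prod_decode (inv r n) of (j, m) \<Rightarrow> (- 1) ^ m * g j x) else 0)" for x n
  have h_le: "norm (h x n) \<le> norm x" for x n
    by (auto simp: h_def norm_mult norm_power g_le split: prod.split)
  define T where "T x = Bcontfun (h x)" for x
  have T: "apply_bcontfun (T x) = h x" for x
    unfolding T_def
    by (intro Bcontfun_inverse) (auto simp: bcontfun_def bounded_iff intro: h_le)
  have T_r: "apply_bcontfun (T x) (r (prod_encode (j, m))) = (- 1) ^ m * g j x" for x j m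
    using strict_mono_imp_inj_on[OF r] by (simp add: T h_def)
  have "isometric_embedding smul T"
    unfolding isometric_embedding_def
  proof
    show "Vector_Spaces.linear smul linf_scale T"
      unfolding Vector_Spaces.linear_iff
    proof (intro conjI allI vector_space_axioms linf.vector_space_axioms)
      show "T (x + y) = T x + T y" "T (smul a x) = linf_scale a (T x)" for x y a
        by (rule bcontfun_eqI; auto simp: T h_def g_add g_scale algebra_simps split: prod.split)+
    qed
    show "\<forall>x. norm (T x) = norm x"
    proof (intro allI antisym)
      fix x
      show "norm (T x) \<le> norm x"
        by (rule norm_bound) (simp add: T h_le)
      show "norm x \<le> norm (T x)"
        \<comment> \<open>The entry with \<open>m = 0\<close> is \<open>g j x\<close>
          itself.\<close>
        using norm_bounded[of "T x" "r (prod_encode (j, 0))" for j]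
        by (intro g_norming) (simp add: T_r)
    qed
  qed
  moreover have "x = 0" if conv: "convergent (apply_bcontfun (T x) \<circ> r)" for x
  proof -
    obtain L where L: "(apply_bcontfun (T x) \<circ> r) \<longlonglongrightarrow> L"
      using conv by (auto simp: convergent_def)
    have "g j x = 0" for j
    proof -
      \<comment> \<open>For fixed \<open>j\<close> the code is at least \<open>m\<close>, so these
        positions tend to infinity.\<close>
      have "filterlim (\<lambda>m. prod_encode (j, m)) sequentially sequentially"
        by (rule filterlim_at_top_mono[OF filterlim_ident]) (simp add: le_prod_encode_2)
      from filterlim_compose[OF L this] have lim: "(\<lambda>m. (- 1) ^ m * g j x) \<longlonglongrightarrow> L"
        by (simp add: T_r)
      \<comment> \<open>Even and odd \<open>m\<close> give constant sequences with opposite values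
        and the same limit \<open>L\<close>.\<close>
      have "(\<lambda>m. (- 1) ^ (2 * m) * g j x) \<longlonglongrightarrow> L" "(\<lambda>m. (- 1) ^ (2 * m + 1) * g j x) \<longlonglongrightarrow> L"
        using LIMSEQ_subseq_LIMSEQ[OF lim, of "\<lambda>m. 2 * m"]
          LIMSEQ_subseq_LIMSEQ[OF lim, of "\<lambda>m. 2 * m + 1"]
        by (simp_all add: strict_mono_def o_def)
      then have "g j x = L" "- g j x = L"
        by (simp_all add: LIMSEQ_const_iff)
      then have "g j x - (- g j x) = 0" by (simp only: diff_self)
      then have "2 * g j x = 0" by (simp only: mult_2 diff_minus_eq_add)
      then show ?thesis by simp
    qed
    then show ?thesis using g_norming[of x 0] by simp
  qed
  ultimately show thesis by (rule that)
qed

section \<open>Trivial intersection with \<open>D + c\<close>, and the space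
  \<open>Z\<close>\<close>

theorem proposition3p1:
  fixes D W :: "'k::real_or_complex linf set"
    and smul :: "'k \<Rightarrow> 'e::banach \<Rightarrow> 'e"
  assumes "linf.subspace D"
    and "countable W" and "linf.independent W" and "linf.span W = D"
    and "D \<inter> conv_seqs = {0}"
    and "normed_space_over smul"
    and "separable_space (euclidean :: 'e topology)"
  shows "(\<exists>T. isometric_embedding smul T \<and> range T \<inter> {d + x | d x. d \<in> D \<and> x \<in> conv_seqs} = {0})
    \<and> (\<exists>Z. linf.subspace Z \<and> D \<subseteq> Z \<and> (\<exists>S. isometric_embedding smul S \<and> range S \<subseteq> Z)
          \<and> Z \<inter> conv_seqs = {0})"
proof -
  obtain r where r: "strict_mono r" "\<And>w. w \<in> W \<Longrightarrow> convergent (apply_bcontfun w \<circ> r)"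
    using ex_common_convergent_subsequence[OF assms(2)] by blast
  obtain T where T: "isometric_embedding smul T"
    and T_div: "\<And>x. convergent (apply_bcontfun (T x) \<circ> r) \<Longrightarrow> x = 0"
    using ex_embedding_divergent_along[OF assms(6,7) r(1)] by blast
  interpret T: Vector_Spaces.linear smul linf_scale T
    using T by (simp add: isometric_embedding_def)
  have "D \<subseteq> {x. convergent (apply_bcontfun x \<circ> r)}"
    unfolding assms(4)[symmetric]
    using r(2) by (intro linf.span_minimal subspace_convergent_along) auto
  then have "convergent (apply_bcontfun (d + x) \<circ> r)" if "d \<in> D" "x \<in> conv_seqs" for d x
  proof -
    have "convergent (apply_bcontfun x \<circ> r)"
      using that(2) r(1) by (auto simp: conv_seqs_def intro: convergent_subseq_convergent)
    then show ?thesis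
      using \<open>D \<subseteq> _\<close> that(1) linf.subspace_add[OF subspace_convergent_along[of r], of d x] by auto
  qed
  then have T_zero: "T x = 0" if "T x = d + y" "d \<in> D" "y \<in> conv_seqs" for x d y
    using T_div[of x] that by simp
  have "0 \<in> D \<inter> conv_seqs" using assms(5) by simp
  then have zero: "0 \<in> D" "(0 :: 'k linf) \<in> conv_seqs" by simp_all
  have "range T \<inter> {d + x | d x. d \<in> D \<and> x \<in> conv_seqs} = {0}"
  proof
    show "range T \<inter> {d + x | d x. d \<in> D \<and> x \<in> conv_seqs} \<subseteq> {0}"
    proof
      fix t
      assume "t \<in> range T \<inter> {d + x | d x. d \<in> D \<and> x \<in> conv_seqs}"
      then obtain x d y where t: "t = T x" "T x = d + y" "d \<in> D" "y \<in> conv_seqs" by blast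
      from T_zero[OF t(2-4)] t(1) show "t \<in> {0}" by simp
    qed
    have "0 = T 0" "(0 :: 'k linf) = 0 + 0" by simp_all
    then show "{0} \<subseteq> range T \<inter> {d + x | d x. d \<in> D \<and> x \<in> conv_seqs}"
      using zero by blast
  qed
  moreover define Z where "Z = {d + t | d t. d \<in> D \<and> t \<in> range T}"
  have "linf.subspace Z"
    unfolding Z_def using assms(1) T.subspace_image[OF T.vs1.subspace_UNIV]
    by (rule linf.subspace_sums)
  moreover have "D \<subseteq> Z"
    unfolding Z_def using T.zero by (metis (mono_tags, lifting) add.right_neutral mem_Collect_eq rangeI subsetI)
  moreover have "range T \<subseteq> Z"
    unfolding Z_def using zero(1) by (metis (mono_tags, lifting) add.left_neutral mem_Collect_eq subsetI)
  moreover have "Z \<inter> conv_seqs = {0}"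
  proof
    show "Z \<inter> conv_seqs \<subseteq> {0}"
    proof
      fix z
      assume "z \<in> Z \<inter> conv_seqs"
      then obtain d x where z: "z = d + T x" "d \<in> D" "z \<in> conv_seqs"
        by (auto simp: Z_def)
      \<comment> \<open>This puts \<open>T x\<close> in \<open>D + c\<close>, so it vanishes and
        \<open>z = d\<close> lies in both \<open>D\<close> and \<open>c\<close>.\<close>
      then have "T x = - d + z" "- d \<in> D"
        using linf.subspace_neg[OF assms(1)] by simp_all
      then have "T x = 0" using z(3) by (rule T_zero)
      then have "z \<in> D \<inter> conv_seqs" using z by simp
      then show "z \<in> {0}" by (simp only: assms(5))
    qed
    show "{0} \<subseteq> Z \<inter> conv_seqs"
      using \<open>D \<subseteq> Z\<close> zero by blast
  qed
  ultimately show ?thesis using T by blast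
qed

end
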